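(* Let $C$ be a category and let $F\colon C\to\mathsf{Ab}$ be a (covariant or contravariant) representable functor to the category of Abelian groups. Then every finite homogeneous functorial semi-norm on $F$ is trivial.
   Context: A finite semi-norm on an Abelian group $A$ is a map $|\cdot| \colon A \to \mathbb{R}_{\ge 0}$ with $|0|=0$, $|-x|=|x|$ and $|x+y|\le |x|+|y|$ for all $x,y\in A$. It is homogeneous if $|n\cdot x| = |n|\cdot|x|$ for all $n\in\mathbb{Z}\setminus\{0\}$ and all $x\in A$. A finite functorial semi-norm on a (co- or contravariant) functor $F\colon C\to\mathsf{Ab}$ is a choice of a finite semi-norm $|\cdot|$ on $F(X)$ for every object $X$ of $C$ such that for every morphism $f$ of $C$ and every $\alpha$ in the domain of the induced homomorphism $F(f)$ we have $|F(f)(\alpha)|\le|\alpha|$. It is homogeneous if all these semi-norms are homogeneous, and it is trivial if $|\alpha|=0$ for all objects $X$ of $C$ and all $\alpha\in F(X)$. A functor $F\colon C\to\mathsf{Ab}$ is representable if, with $V\colon\mathsf{Ab}\to\mathsf{Set}$ denoting the forgetful functor, there is an object $Y$ of $C$ and a natural isomorphism $V\circ F\cong\mathrm{Mor}_C(Y,\cdot)$ of set-valued functors in the covariant case, respectively $V\circ F\cong\mathrm{Mor}_C(\cdot,Y)$ in the contravariant case. *)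

theory Defs
  imports Complex_Main "HOL-Algebra.Group"
begin

section \<open>Categories\<close>

record ('o, 'm) category =
  Obj :: "'o set"
  Arr :: "'m set"
  Dom :: "'m \<Rightarrow> 'o"
  Cod :: "'m \<Rightarrow> 'o"
  Id :: "'o \<Rightarrow> 'm"
  Comp :: "'m \<Rightarrow> 'm \<Rightarrow> 'm"

definition Mor :: "('o, 'm) category \<Rightarrow> 'o \<Rightarrow> 'o \<Rightarrow> 'm set"
  where "Mor C X Y = {f \<in> Arr C. Dom C f = X \<and> Cod C f = Y}"

text \<open>Composition is written in the order of functions: \<open>Comp C g f\<close> is \<open>g\<close> after \<open>f\<close>.
  Nothing is assumed about the operations on elements outside \<open>Obj C\<close> and \<open>Arr C\<close>, nor about
  \<open>Comp\<close> on arrows that are not composable.\<close>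

locale category =
  fixes C :: "('o, 'm) category"
  assumes Dom_in_Obj: "f \<in> Arr C \<Longrightarrow> Dom C f \<in> Obj C"
    and Cod_in_Obj: "f \<in> Arr C \<Longrightarrow> Cod C f \<in> Obj C"
    and Id_in_Mor: "X \<in> Obj C \<Longrightarrow> Id C X \<in> Mor C X X"
    and Comp_in_Mor: "f \<in> Mor C X Y \<Longrightarrow> g \<in> Mor C Y Z \<Longrightarrow> Comp C g f \<in> Mor C X Z"
    and Comp_Id: "f \<in> Mor C X Y \<Longrightarrow> Comp C f (Id C X) = f"
    and Id_Comp: "f \<in> Mor C X Y \<Longrightarrow> Comp C (Id C Y) f = f"
    and Comp_assoc: "f \<in> Mor C W X \<Longrightarrow> g \<in> Mor C X Y \<Longrightarrow> h \<in> Mor C Y Z \<Longrightarrow>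
      Comp C h (Comp C g f) = Comp C (Comp C h g) f"


section \<open>Functors to sets and natural isomorphisms\<close>

text \<open>All values of a functor are sets of elements of one type. This is no restriction of the
  mathematics, since a family of sets can be embedded disjointly into one type. The map induced
  by an arrow matters only on the set on which it is defined.\<close>

record ('o, 'm, 'a) set_functor =
  set_ob :: "'o \<Rightarrow> 'a set"
  set_map :: "'m \<Rightarrow> 'a \<Rightarrow> 'a"

definition cov_set_functor :: "('o, 'm) category \<Rightarrow> ('o, 'm, 'a) set_functor \<Rightarrow> bool"
  where "cov_set_functor C S \<longleftrightarrow>
    (\<forall>X\<in>Obj C. \<forall>Y\<in>Obj C. \<forall>f\<in>Mor C X Y. \<forall>x\<in>set_ob S X. set_map S f x \<in> set_ob S Y) \<and>
    (\<forall>X\<in>Obj C. \<forall>x\<in>set_ob S X. set_map S (Id C X) x = x) \<and>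
    (\<forall>X\<in>Obj C. \<forall>Y\<in>Obj C. \<forall>Z\<in>Obj C. \<forall>f\<in>Mor C X Y. \<forall>g\<in>Mor C Y Z. \<forall>x\<in>set_ob S X.
       set_map S (Comp C g f) x = set_map S g (set_map S f x))"

definition contra_set_functor :: "('o, 'm) category \<Rightarrow> ('o, 'm, 'a) set_functor \<Rightarrow> bool"
  where "contra_set_functor C S \<longleftrightarrow>
    (\<forall>X\<in>Obj C. \<forall>Y\<in>Obj C. \<forall>f\<in>Mor C X Y. \<forall>y\<in>set_ob S Y. set_map S f y \<in> set_ob S X) \<and>
    (\<forall>X\<in>Obj C. \<forall>x\<in>set_ob S X. set_map S (Id C X) x = x) \<and>
    (\<forall>X\<in>Obj C. \<forall>Y\<in>Obj C. \<forall>Z\<in>Obj C. \<forall>f\<in>Mor C X Y. \<forall>g\<in>Mor C Y Z. \<forall>z\<in>set_ob S Z.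
       set_map S (Comp C g f) z = set_map S f (set_map S g z))"

definition cov_naturally_isomorphic ::
    "('o, 'm) category \<Rightarrow> ('o, 'm, 'a) set_functor \<Rightarrow> ('o, 'm, 'b) set_functor \<Rightarrow> bool"
  where "cov_naturally_isomorphic C S T \<longleftrightarrow> (\<exists>\<eta> :: 'o \<Rightarrow> 'a \<Rightarrow> 'b.
    (\<forall>X\<in>Obj C. bij_betw (\<eta> X) (set_ob S X) (set_ob T X)) \<and>
    (\<forall>X\<in>Obj C. \<forall>Y\<in>Obj C. \<forall>f\<in>Mor C X Y. \<forall>x\<in>set_ob S X.
       \<eta> Y (set_map S f x) = set_map T f (\<eta> X x)))"

definition contra_naturally_isomorphic ::
    "('o, 'm) category \<Rightarrow> ('o, 'm, 'a) set_functor \<Rightarrow> ('o, 'm, 'b) set_functor \<Rightarrow> bool"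
  where "contra_naturally_isomorphic C S T \<longleftrightarrow> (\<exists>\<eta> :: 'o \<Rightarrow> 'a \<Rightarrow> 'b.
    (\<forall>X\<in>Obj C. bij_betw (\<eta> X) (set_ob S X) (set_ob T X)) \<and>
    (\<forall>X\<in>Obj C. \<forall>Y\<in>Obj C. \<forall>f\<in>Mor C X Y. \<forall>y\<in>set_ob S Y.
       \<eta> X (set_map S f y) = set_map T f (\<eta> Y y)))"

definition cov_hom :: "('o, 'm) category \<Rightarrow> 'o \<Rightarrow> ('o, 'm, 'm) set_functor"
  where "cov_hom C Y = \<lparr>set_ob = (\<lambda>X. Mor C Y X), set_map = (\<lambda>f g. Comp C f g)\<rparr>"

definition contra_hom :: "('o, 'm) category \<Rightarrow> 'o \<Rightarrow> ('o, 'm, 'm) set_functor"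
  where "contra_hom C Y = \<lparr>set_ob = (\<lambda>X. Mor C X Y), set_map = (\<lambda>f g. Comp C g f)\<rparr>"

lemma (in category) cov_set_functor_cov_hom: "cov_set_functor C (cov_hom C Y)"
  unfolding cov_set_functor_def cov_hom_def
  by (auto intro: Comp_in_Mor simp: Id_Comp Comp_assoc)

lemma (in category) contra_set_functor_contra_hom: "contra_set_functor C (contra_hom C Y)"
  unfolding contra_set_functor_def contra_hom_def
  by (auto intro: Comp_in_Mor simp: Comp_Id Comp_assoc)


section \<open>Functors to Abelian groups\<close>

text \<open>Abelian groups are the library's commutative groups, written multiplicatively.\<close>

record ('o, 'm, 'a) ab_functor =
  ab_ob :: "'o \<Rightarrow> 'a monoid"
  ab_map :: "'m \<Rightarrow> 'a \<Rightarrow> 'a"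

locale cov_ab_functor = category C for C :: "('o, 'm) category" +
  fixes F :: "('o, 'm, 'a) ab_functor"
  assumes comm_group_ob: "X \<in> Obj C \<Longrightarrow> comm_group (ab_ob F X)"
    and map_hom: "f \<in> Mor C X Y \<Longrightarrow> ab_map F f \<in> hom (ab_ob F X) (ab_ob F Y)"
    and map_Id: "X \<in> Obj C \<Longrightarrow> \<alpha> \<in> carrier (ab_ob F X) \<Longrightarrow> ab_map F (Id C X) \<alpha> = \<alpha>"
    and map_Comp: "f \<in> Mor C X Y \<Longrightarrow> g \<in> Mor C Y Z \<Longrightarrow> \<alpha> \<in> carrier (ab_ob F X) \<Longrightarrow>
      ab_map F (Comp C g f) \<alpha> = ab_map F g (ab_map F f \<alpha>)"

locale contra_ab_functor = category C for C :: "('o, 'm) category" +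
  fixes F :: "('o, 'm, 'a) ab_functor"
  assumes comm_group_ob: "X \<in> Obj C \<Longrightarrow> comm_group (ab_ob F X)"
    and map_hom: "f \<in> Mor C X Y \<Longrightarrow> ab_map F f \<in> hom (ab_ob F Y) (ab_ob F X)"
    and map_Id: "X \<in> Obj C \<Longrightarrow> \<alpha> \<in> carrier (ab_ob F X) \<Longrightarrow> ab_map F (Id C X) \<alpha> = \<alpha>"
    and map_Comp: "f \<in> Mor C X Y \<Longrightarrow> g \<in> Mor C Y Z \<Longrightarrow> \<alpha> \<in> carrier (ab_ob F Z) \<Longrightarrow>
      ab_map F (Comp C g f) \<alpha> = ab_map F f (ab_map F g \<alpha>)"

text \<open>The composite of \<open>F\<close> with the forgetful functor from Abelian groups to sets.\<close>

definition forget :: "('o, 'm, 'a) ab_functor \<Rightarrow> ('o, 'm, 'a) set_functor"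
  where "forget F = \<lparr>set_ob = (\<lambda>X. carrier (ab_ob F X)), set_map = ab_map F\<rparr>"

lemma (in cov_ab_functor) cov_set_functor_forget: "cov_set_functor C (forget F)"
  unfolding cov_set_functor_def forget_def
  by (auto simp: map_Id map_Comp intro: hom_in_carrier[OF map_hom])

lemma (in contra_ab_functor) contra_set_functor_forget: "contra_set_functor C (forget F)"
  unfolding contra_set_functor_def forget_def
  by (auto simp: map_Id map_Comp intro: hom_in_carrier[OF map_hom])

definition cov_representable :: "('o, 'm) category \<Rightarrow> ('o, 'm, 'a) ab_functor \<Rightarrow> bool"
  where "cov_representable C F \<longleftrightarrow>
    (\<exists>Y\<in>Obj C. cov_naturally_isomorphic C (forget F) (cov_hom C Y))"

definition contra_representable :: "('o, 'm) category \<Rightarrow> ('o, 'm, 'a) ab_functor \<Rightarrow> bool"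
  where "contra_representable C F \<longleftrightarrow>
    (\<exists>Y\<in>Obj C. contra_naturally_isomorphic C (forget F) (contra_hom C Y))"


section \<open>Functorial semi-norms\<close>

definition finite_seminorm :: "('a, 'b) monoid_scheme \<Rightarrow> ('a \<Rightarrow> real) \<Rightarrow> bool"
  where "finite_seminorm A \<nu> \<longleftrightarrow>
    (\<forall>x\<in>carrier A. 0 \<le> \<nu> x) \<and>
    \<nu> \<one>\<^bsub>A\<^esub> = 0 \<and>
    (\<forall>x\<in>carrier A. \<nu> (inv\<^bsub>A\<^esub> x) = \<nu> x) \<and>
    (\<forall>x\<in>carrier A. \<forall>y\<in>carrier A. \<nu> (x \<otimes>\<^bsub>A\<^esub> y) \<le> \<nu> x + \<nu> y)"

definition homogeneous :: "('a, 'b) monoid_scheme \<Rightarrow> ('a \<Rightarrow> real) \<Rightarrow> bool"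
  where "homogeneous A \<nu> \<longleftrightarrow>
    (\<forall>n::int. n \<noteq> 0 \<longrightarrow> (\<forall>x\<in>carrier A. \<nu> (x [^]\<^bsub>A\<^esub> n) = real_of_int \<bar>n\<bar> * \<nu> x))"

definition cov_functorial_seminorm ::
    "('o, 'm) category \<Rightarrow> ('o, 'm, 'a) ab_functor \<Rightarrow> ('o \<Rightarrow> 'a \<Rightarrow> real) \<Rightarrow> bool"
  where "cov_functorial_seminorm C F \<nu> \<longleftrightarrow>
    (\<forall>X\<in>Obj C. finite_seminorm (ab_ob F X) (\<nu> X)) \<and>
    (\<forall>X\<in>Obj C. \<forall>Y\<in>Obj C. \<forall>f\<in>Mor C X Y. \<forall>\<alpha>\<in>carrier (ab_ob F X).
       \<nu> Y (ab_map F f \<alpha>) \<le> \<nu> X \<alpha>)"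

definition contra_functorial_seminorm ::
    "('o, 'm) category \<Rightarrow> ('o, 'm, 'a) ab_functor \<Rightarrow> ('o \<Rightarrow> 'a \<Rightarrow> real) \<Rightarrow> bool"
  where "contra_functorial_seminorm C F \<nu> \<longleftrightarrow>
    (\<forall>X\<in>Obj C. finite_seminorm (ab_ob F X) (\<nu> X)) \<and>
    (\<forall>X\<in>Obj C. \<forall>Y\<in>Obj C. \<forall>f\<in>Mor C X Y. \<forall>\<alpha>\<in>carrier (ab_ob F Y).
       \<nu> X (ab_map F f \<alpha>) \<le> \<nu> Y \<alpha>)"

definition homogeneous_on ::
    "('o, 'm) category \<Rightarrow> ('o, 'm, 'a) ab_functor \<Rightarrow> ('o \<Rightarrow> 'a \<Rightarrow> real) \<Rightarrow> bool"
  where "homogeneous_on C F \<nu> \<longleftrightarrow> (\<forall>X\<in>Obj C. homogeneous (ab_ob F X) (\<nu> X))"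

definition trivial_on ::
    "('o, 'm) category \<Rightarrow> ('o, 'm, 'a) ab_functor \<Rightarrow> ('o \<Rightarrow> 'a \<Rightarrow> real) \<Rightarrow> bool"
  where "trivial_on C F \<nu> \<longleftrightarrow> (\<forall>X\<in>Obj C. \<forall>\<alpha>\<in>carrier (ab_ob F X). \<nu> X \<alpha> = 0)"

end

theory Submission
  imports Defs
begin

text \<open>By the Yoneda lemma, a functor represented by \<open>Y\<close> has a universal element \<open>u\<close> in \<open>F Y\<close>:
  every element of every \<open>F X\<close> is the image of \<open>u\<close> under an induced map. A functorial semi-norm
  is therefore bounded on all of \<open>F\<close> by the semi-norm of \<open>u\<close>, and a bounded homogeneous semi-norm
  vanishes, because the multiples of an element of nonzero semi-norm are unbounded.\<close>

lemma bounded_homogeneous_eq_zero: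
  assumes "group A" and norm: "finite_seminorm A \<nu>" and hom: "homogeneous A \<nu>"
    and bound: "\<And>x. x \<in> carrier A \<Longrightarrow> \<nu> x \<le> B"
    and x: "x \<in> carrier A"
  shows "\<nu> x = 0"
proof (rule ccontr)
  assume "\<nu> x \<noteq> 0"
  with norm x have "0 < \<nu> x"
    by (auto simp: finite_seminorm_def less_le)
  then obtain n :: nat where n: "B < real n * \<nu> x"
    using reals_Archimedean3 by blast
  \<comment> \<open>Homogeneity speaks only of nonzero exponents. Passing from \<open>n\<close> to
    \<open>Suc n\<close> makes the exponent visibly nonzero and only enlarges a product that already
    exceeds \<open>B\<close>.\<close>
  have "real (Suc n) * \<nu> x = \<nu> (x [^]\<^bsub>A\<^esub> int (Suc n))"
    using hom x unfolding homogeneous_def by (metis abs_of_nat of_int_of_nat_eq of_nat_eq_0_iff nat.distinct(2))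
  also have "\<dots> \<le> B"
    using bound group.int_pow_closed[OF \<open>group A\<close> x] by blast
  finally show False
    using n \<open>0 < \<nu> x\<close> by (simp add: distrib_right)
qed

text \<open>Under the natural bijection, \<open>u\<close> corresponds to the identity of
  \<open>Y\<close>, and the arrow that carries \<open>u\<close> to \<alpha> is the one that
  corresponds to \<alpha> itself.\<close>

lemma (in cov_ab_functor) universal_element:
  assumes "cov_representable C F"
  obtains Y u where "Y \<in> Obj C" "u \<in> carrier (ab_ob F Y)"
    "\<And>X \<alpha>. X \<in> Obj C \<Longrightarrow> \<alpha> \<in> carrier (ab_ob F X) \<Longrightarrow> \<exists>f\<in>Mor C Y X. ab_map F f u = \<alpha>"
proof -
  from assms obtain Y \<eta> where Y: "Y \<in> Obj C"
    and iso: "\<forall>X\<in>Obj C. bij_betw (\<eta> X) (carrier (ab_ob F X)) (Mor C Y X)"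
      "\<forall>X\<in>Obj C. \<forall>Z\<in>Obj C. \<forall>f\<in>Mor C X Z. \<forall>x\<in>carrier (ab_ob F X).
        \<eta> Z (ab_map F f x) = Comp C f (\<eta> X x)"
    unfolding cov_representable_def cov_naturally_isomorphic_def forget_def cov_hom_def by auto
  note bij = bspec[OF iso(1)] and nat = iso(2)[rule_format]
  \<comment> \<open>Surjectivity of \<open>\<eta> Y\<close> onto the endomorphisms of
    \<open>Y\<close> provides a preimage of the identity.\<close>
  from bij[OF Y] Id_in_Mor[OF Y] obtain u where u: "u \<in> carrier (ab_ob F Y)" "\<eta> Y u = Id C Y"
    unfolding bij_betw_def by (metis imageE)
  show thesis
  proof (rule that[OF Y u(1)])
    fix X \<alpha> assume X: "X \<in> Obj C" and \<alpha>: "\<alpha> \<in> carrier (ab_ob F X)"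
    have f: "\<eta> X \<alpha> \<in> Mor C Y X"
      using bij[OF X] \<alpha> by (rule bij_betw_apply)
    \<comment> \<open>Naturality along the arrow \<open>\<eta> X \<alpha>\<close>, evaluated at
      \<open>u\<close>, turns the left side into this arrow composed with the identity of
      \<open>Y\<close>. Injectivity of \<open>\<eta> X\<close> then removes \<open>\<eta> X\<close>
      from both sides.\<close>
    have "\<eta> X (ab_map F (\<eta> X \<alpha>) u) = \<eta> X \<alpha>"
      using nat[OF Y X f u(1)] u(2) Comp_Id[OF f] by simp
    then have "ab_map F (\<eta> X \<alpha>) u = \<alpha>"
      using bij_betw_imp_inj_on[OF bij[OF X]] hom_in_carrier[OF map_hom[OF f] u(1)] \<alpha>
      by (auto dest: inj_onD)
    with f show "\<exists>f\<in>Mor C Y X. ab_map F f u = \<alpha>" ..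
  qed
qed

text \<open>Dual to the covariant case: the arrow corresponding to \<alpha> now ends at
  \<open>Y\<close>, and its induced map pulls \<open>u\<close> back to \<alpha>.\<close>

lemma (in contra_ab_functor) universal_element:
  assumes "contra_representable C F"
  obtains Y u where "Y \<in> Obj C" "u \<in> carrier (ab_ob F Y)"
    "\<And>X \<alpha>. X \<in> Obj C \<Longrightarrow> \<alpha> \<in> carrier (ab_ob F X) \<Longrightarrow> \<exists>f\<in>Mor C X Y. ab_map F f u = \<alpha>"
proof -
  from assms obtain Y \<eta> where Y: "Y \<in> Obj C"
    and iso: "\<forall>X\<in>Obj C. bij_betw (\<eta> X) (carrier (ab_ob F X)) (Mor C X Y)"
      "\<forall>X\<in>Obj C. \<forall>Z\<in>Obj C. \<forall>f\<in>Mor C X Z. \<forall>x\<in>carrier (ab_ob F Z).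
        \<eta> X (ab_map F f x) = Comp C (\<eta> Z x) f"
    unfolding contra_representable_def contra_naturally_isomorphic_def forget_def contra_hom_def by auto
  note bij = bspec[OF iso(1)] and nat = iso(2)[rule_format]
  from bij[OF Y] Id_in_Mor[OF Y] obtain u where u: "u \<in> carrier (ab_ob F Y)" "\<eta> Y u = Id C Y"
    unfolding bij_betw_def by (metis imageE)
  show thesis
  proof (rule that[OF Y u(1)])
    fix X \<alpha> assume X: "X \<in> Obj C" and \<alpha>: "\<alpha> \<in> carrier (ab_ob F X)"
    have f: "\<eta> X \<alpha> \<in> Mor C X Y"
      using bij[OF X] \<alpha> by (rule bij_betw_apply)
    have "\<eta> X (ab_map F (\<eta> X \<alpha>) u) = \<eta> X \<alpha>"
      \<comment> \<open>The arrow is now precomposed, so the identity of \<open>Y\<close> stands on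
        the left and the other unit law cancels it.\<close>
      using nat[OF X Y f u(1)] u(2) Id_Comp[OF f] by simp
    then have "ab_map F (\<eta> X \<alpha>) u = \<alpha>"
      using bij_betw_imp_inj_on[OF bij[OF X]] hom_in_carrier[OF map_hom[OF f] u(1)] \<alpha>
      by (auto dest: inj_onD)
    with f show "\<exists>f\<in>Mor C X Y. ab_map F f u = \<alpha>" ..
  qed
qed

lemma (in cov_ab_functor) representable_trivial_on:
  assumes rep: "cov_representable C F"
    and norm: "cov_functorial_seminorm C F \<nu>" and hom: "homogeneous_on C F \<nu>"
  shows "trivial_on C F \<nu>"
proof -
  obtain Y u where Y: "Y \<in> Obj C" and u: "u \<in> carrier (ab_ob F Y)"
    and univ: "\<And>X \<alpha>. X \<in> Obj C \<Longrightarrow> \<alpha> \<in> carrier (ab_ob F X) \<Longrightarrow> \<exists>f\<in>Mor C Y X. ab_map F f u = \<alpha>"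
    using universal_element[OF rep] by blast
  \<comment> \<open>Induced maps do not increase the semi-norm and \<alpha> is an image of
    \<open>u\<close>, so one constant serves for all objects and all elements.\<close>
  have bound: "\<nu> X \<alpha> \<le> \<nu> Y u" if "X \<in> Obj C" "\<alpha> \<in> carrier (ab_ob F X)" for X \<alpha>
    using univ[OF that] norm Y u that(1) unfolding cov_functorial_seminorm_def by blast
  have "\<nu> X \<alpha> = 0" if X: "X \<in> Obj C" and \<alpha>: "\<alpha> \<in> carrier (ab_ob F X)" for X \<alpha>
  \<comment> \<open>For fixed \<open>X\<close>, the bound \<open>B\<close> is the real number
    \<open>\<nu> Y u\<close>, which covers all powers of \<alpha> in \<open>ab_ob F X\<close> at
    once.\<close>
  proof (rule bounded_homogeneous_eq_zero[OF _ _ _ bound[OF X] \<alpha>])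
    show "group (ab_ob F X)"
      using comm_group_ob[OF X] by (rule comm_group.axioms)
    show "finite_seminorm (ab_ob F X) (\<nu> X)" "homogeneous (ab_ob F X) (\<nu> X)"
      using norm hom X by (auto simp: cov_functorial_seminorm_def homogeneous_on_def)
  qed
  then show ?thesis
    by (simp add: trivial_on_def)
qed

lemma (in contra_ab_functor) representable_trivial_on:
  assumes rep: "contra_representable C F"
    and norm: "contra_functorial_seminorm C F \<nu>" and hom: "homogeneous_on C F \<nu>"
  shows "trivial_on C F \<nu>"
proof -
  obtain Y u where Y: "Y \<in> Obj C" and u: "u \<in> carrier (ab_ob F Y)"
    and univ: "\<And>X \<alpha>. X \<in> Obj C \<Longrightarrow> \<alpha> \<in> carrier (ab_ob F X) \<Longrightarrow> \<exists>f\<in>Mor C X Y. ab_map F f u = \<alpha>"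
    using universal_element[OF rep] by blast
  \<comment> \<open>Here \<alpha> is a pullback of \<open>u\<close> along an arrow into
    \<open>Y\<close>, and functoriality again bounds it by the semi-norm of
    \<open>u\<close>.\<close>
  have bound: "\<nu> X \<alpha> \<le> \<nu> Y u" if "X \<in> Obj C" "\<alpha> \<in> carrier (ab_ob F X)" for X \<alpha>
    using univ[OF that] norm Y u that(1) unfolding contra_functorial_seminorm_def by blast
  have "\<nu> X \<alpha> = 0" if X: "X \<in> Obj C" and \<alpha>: "\<alpha> \<in> carrier (ab_ob F X)" for X \<alpha>
  proof (rule bounded_homogeneous_eq_zero[OF _ _ _ bound[OF X] \<alpha>])
    show "group (ab_ob F X)"
      using comm_group_ob[OF X] by (rule comm_group.axioms)
    show "finite_seminorm (ab_ob F X) (\<nu> X)" "homogeneous (ab_ob F X) (\<nu> X)"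
      using norm hom X by (auto simp: contra_functorial_seminorm_def homogeneous_on_def)
  qed
  then show ?thesis
    by (simp add: trivial_on_def)
qed

theorem corollary4p1:
  fixes C :: "('o, 'm) category"
    and F :: "('o, 'm, 'a) ab_functor"
  assumes "category C"
  shows "(cov_ab_functor C F \<and> cov_representable C F \<longrightarrow>
           (\<forall>\<nu>. cov_functorial_seminorm C F \<nu> \<and> homogeneous_on C F \<nu> \<longrightarrow> trivial_on C F \<nu>))
       \<and> (contra_ab_functor C F \<and> contra_representable C F \<longrightarrow>
           (\<forall>\<nu>. contra_functorial_seminorm C F \<nu> \<and> homogeneous_on C F \<nu> \<longrightarrow> trivial_on C F \<nu>))"
  using cov_ab_functor.representable_trivial_on contra_ab_functor.representable_trivial_on by blast

end
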